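(* For any $n\ge1$ and any pattern pair $p\in\{(001,110),(001,021),(001,120)\}$, we have $|\mathbf{I}_n(p)|=\binom{n}{2}+1$, the $n$-th central polygonal number.
   Context: An inversion sequence of length $n$ is an integer sequence $e=(e_1,\dots,e_n)$ with $0\le e_i\le i-1$ for all $1\le i\le n$. A word $w_1\cdots w_n$ avoids a pattern $P=p_1\cdots p_k$ if there are no $i_1<\cdots<i_k$ such that $w_{i_1}\cdots w_{i_k}$ is order isomorphic to $P$ (equal letters of $P$ corresponding to equal entries). For a pair $p=(P_1,P_2)$ of patterns, $\mathbf{I}_n(p)$ denotes the set of inversion sequences of length $n$ avoiding both $P_1$ and $P_2$. The sequence of central polygonal numbers is $\{n(n-1)/2+1\}_{n\ge1}$. *)

theory Defs
  imports Complex_Main "HOL-Library.Sublist"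
begin

text \<open>Lists are indexed from 0, so the entry written \<open>e\<^sub>i\<close> in 1-based notation is \<open>e ! (i - 1)\<close>
  and the bound \<open>0 \<le> e\<^sub>i \<le> i - 1\<close> becomes \<open>e ! i \<le> i\<close>.\<close>

definition inversion_sequence :: "nat list \<Rightarrow> bool" where
  "inversion_sequence e \<longleftrightarrow> (\<forall>i<length e. e ! i \<le> i)"

definition order_isomorphic :: "nat list \<Rightarrow> nat list \<Rightarrow> bool" where
  "order_isomorphic u v \<longleftrightarrow> length u = length v \<and>
     (\<forall>i<length u. \<forall>j<length u.
        (u ! i < u ! j \<longleftrightarrow> v ! i < v ! j) \<and> (u ! i = u ! j \<longleftrightarrow> v ! i = v ! j))"

text \<open>\<^const>\<open>subseq\<close> is the relation of being a not necessarily contiguous subsequence.\<close>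

definition avoids :: "nat list \<Rightarrow> nat list \<Rightarrow> bool" where
  "avoids w P \<longleftrightarrow> \<not> (\<exists>u. subseq u w \<and> order_isomorphic u P)"

definition inversion_sequences_avoiding :: "nat \<Rightarrow> nat list \<times> nat list \<Rightarrow> nat list set" where
  "inversion_sequences_avoiding n p =
     {e. length e = n \<and> inversion_sequence e \<and> avoids e (fst p) \<and> avoids e (snd p)}"

definition central_polygonal :: "nat \<Rightarrow> nat" where
  "central_polygonal n = n * (n - 1) div 2 + 1"

end

theory Submission
  imports Defs
begin

text \<open>An inversion sequence \<open>e\<close> of length \<open>n\<close> that avoids 001 climbs \<open>0, 1, \<dots>, m - 1\<close> up to the
  first position \<open>m\<close> at which the bound \<open>e ! i \<le> i\<close> is strict. From there on every entry repeats an
  entry of the climb, so that nothing larger may follow it: the tail is weakly decreasing with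
  values below \<open>m\<close> (\<open>avoids_001_climb\<close>). The second pattern then leaves few tails.

  \<^item> 110 forces a constant tail, since its first value \<open>a < m\<close> already occurs in the climb and so
    cannot be followed by anything smaller.
  \<^item> 021 forces tail values in \<open>{0, m - 1}\<close>: a value \<open>v\<close> strictly between would complete
    \<open>0, m - 1, v\<close>.
  \<^item> 120 forces tail values in \<open>{m - 2, m - 1}\<close>: a smaller value \<open>v\<close> would complete
    \<open>m - 2, m - 1, v\<close>.

  In the first case the words other than \<open>0, 1, \<dots>, n - 1\<close> are given by pairs \<open>a < m < n\<close>. In the
  other two cases the words other than \<open>0, 0, \<dots>, 0\<close> are given by the maximum \<open>a + 1\<close> and the last
  position \<open>b\<close> of that maximum, where \<open>a < b < n\<close>. Each time there are \<open>n choose 2\<close> words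
  and one exceptional word.\<close>

section \<open>Pattern avoidance in terms of positions\<close>

lemma subseq_Cons_iff_nth:
  "subseq (x # xs) w \<longleftrightarrow> (\<exists>i<length w. w ! i = x \<and> subseq xs (drop (Suc i) w))"
proof (induction w)
  case Nil
  then show ?case by simp
next
  case (Cons y w)
  have "subseq (x # xs) (y # w) \<longleftrightarrow> x = y \<and> subseq xs w \<or> subseq (x # xs) w"
    by (auto simp: subseq_Cons2_iff dest: subseq_Cons')
  also have "\<dots> \<longleftrightarrow> (\<exists>i<length (y # w). (y # w) ! i = x \<and> subseq xs (drop (Suc i) (y # w)))"
    unfolding Cons.IH by (auto simp: Ex_less_Suc2)
  finally show ?case .
qed

lemma subseq_triple_iff_nth:
  "subseq [x, y, z] w \<longleftrightarrow>
     (\<exists>i j k. i < j \<and> j < k \<and> k < length w \<and> w ! i = x \<and> w ! j = y \<and> w ! k = z)"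
proof
  assume "subseq [x, y, z] w"
  then obtain i j k where "i < length w" "w ! i = x"
    and "j < length w - Suc i" "w ! (Suc i + j) = y"
    and "k < length w - Suc (Suc i + j)" "w ! (Suc (Suc i + j) + k) = z"
    by (auto simp: subseq_Cons_iff_nth add_ac)
  then have "i < Suc i + j \<and> Suc i + j < Suc (Suc i + j) + k \<and> Suc (Suc i + j) + k < length w \<and>
      w ! i = x \<and> w ! (Suc i + j) = y \<and> w ! (Suc (Suc i + j) + k) = z"
    by linarith
  then show "\<exists>i j k. i < j \<and> j < k \<and> k < length w \<and> w ! i = x \<and> w ! j = y \<and> w ! k = z"
    by blast
next
  assume "\<exists>i j k. i < j \<and> j < k \<and> k < length w \<and> w ! i = x \<and> w ! j = y \<and> w ! k = z"
  then obtain i j k where *: "i < j" "j < k" "k < length w" "w ! i = x" "w ! j = y" "w ! k = z"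
    by blast
  have "subseq [z] (drop (Suc j) w)"
    using * by (auto simp: subseq_Cons_iff_nth intro!: exI[of _ "k - Suc j"])
  then have "subseq [y, z] (drop (Suc i) w)"
    using * by (subst subseq_Cons_iff_nth) (auto intro!: exI[of _ "j - Suc i"])
  then show "subseq [x, y, z] w"
    using * by (subst subseq_Cons_iff_nth) (auto intro!: exI[of _ i])
qed

lemma inversion_sequences_avoiding_Pair:
  "e \<in> inversion_sequences_avoiding n (P, Q) \<longleftrightarrow>
     length e = n \<and> inversion_sequence e \<and> avoids e P \<and> avoids e Q"
  by (simp add: inversion_sequences_avoiding_def)

lemma avoids_triple:
  "avoids w [p, q, r] \<longleftrightarrow>
     (\<forall>i j k. i < j \<longrightarrow> j < k \<longrightarrow> k < length w \<longrightarrow> \<not> order_isomorphic [w ! i, w ! j, w ! k] [p, q, r])"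
proof -
  have "length u = 3" if "order_isomorphic u [p, q, r]" for u
    using that by (simp add: order_isomorphic_def)
  then have "(\<exists>u. subseq u w \<and> order_isomorphic u [p, q, r]) \<longleftrightarrow>
      (\<exists>x y z. subseq [x, y, z] w \<and> order_isomorphic [x, y, z] [p, q, r])"
    by (auto simp: numeral_3_eq_3 length_Suc_conv) blast
  then show ?thesis
    unfolding avoids_def subseq_triple_iff_nth by blast
qed

lemma order_isomorphic_triple:
  "order_isomorphic [x, y, z] [p, q, r] \<longleftrightarrow>
     (x < y \<longleftrightarrow> p < q) \<and> (y < x \<longleftrightarrow> q < p) \<and> (x < z \<longleftrightarrow> p < r) \<and> (z < x \<longleftrightarrow> r < p) \<and>
     (y < z \<longleftrightarrow> q < r) \<and> (z < y \<longleftrightarrow> r < q)"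
  by (auto simp: order_isomorphic_def All_less_Suc2 nat_neq_iff)

lemma avoids_001:
  "avoids w [0, 0, 1] \<longleftrightarrow>
     (\<forall>i j k. i < j \<longrightarrow> j < k \<longrightarrow> k < length w \<longrightarrow> w ! i = w ! j \<longrightarrow> w ! k \<le> w ! j)"
  unfolding avoids_triple order_isomorphic_triple
  by (intro iff_allI imp_cong refl) (simp, linarith)

lemma avoids_110:
  "avoids w [1, 1, 0] \<longleftrightarrow>
     (\<forall>i j k. i < j \<longrightarrow> j < k \<longrightarrow> k < length w \<longrightarrow> w ! i = w ! j \<longrightarrow> w ! j \<le> w ! k)"
  unfolding avoids_triple order_isomorphic_triple
  by (intro iff_allI imp_cong refl) (simp, linarith)

lemma avoids_021:
  "avoids w [0, 2, 1] \<longleftrightarrow>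
     (\<forall>i j k. i < j \<longrightarrow> j < k \<longrightarrow> k < length w \<longrightarrow> w ! i < w ! k \<longrightarrow> w ! j \<le> w ! k)"
  unfolding avoids_triple order_isomorphic_triple
  by (intro iff_allI imp_cong refl) (simp, linarith)

lemma avoids_120:
  "avoids w [1, 2, 0] \<longleftrightarrow>
     (\<forall>i j k. i < j \<longrightarrow> j < k \<longrightarrow> k < length w \<longrightarrow> w ! i < w ! j \<longrightarrow> w ! i \<le> w ! k)"
  unfolding avoids_triple order_isomorphic_triple
  by (intro iff_allI imp_cong refl) (simp, linarith)

section \<open>Inversion sequences avoiding 001\<close>

text \<open>The number \<open>m\<close> is the first position with \<open>e ! m \<noteq> m\<close>, or the length of \<open>e\<close> if
  \<open>e\<close> climbs to its end. Each tail entry \<open>v < m\<close> equals the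
  entry at position \<open>v\<close> of the climb, and this repetition bounds everything to its right.\<close>

lemma avoids_001_climb:
  assumes "inversion_sequence e" "avoids e [0, 0, 1]" "e \<noteq> []"
  obtains m where "0 < m" "m \<le> length e"
    and "\<And>i. i < m \<Longrightarrow> e ! i = i"
    and "\<And>i. m \<le> i \<Longrightarrow> i < length e \<Longrightarrow> e ! i < m"
    and "\<And>i j. m \<le> i \<Longrightarrow> i \<le> j \<Longrightarrow> j < length e \<Longrightarrow> e ! j \<le> e ! i"
proof -
  define m where "m = (LEAST i. i = length e \<or> e ! i \<noteq> i)"
  have m: "m = length e \<or> e ! m \<noteq> m"
    unfolding m_def by (rule LeastI[of _ "length e"]) simp
  have le: "m \<le> length e"
    unfolding m_def by (rule Least_le) simp
  have climb: "e ! i = i" if "i < m" for i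
    using not_less_Least[OF that[unfolded m_def]] by simp
  have bound: "e ! i \<le> i" if "i < length e" for i
    using assms(1) that by (simp add: inversion_sequence_def)
  have repeated: "e ! j \<le> e ! i" if "e ! i < m" "m \<le> i" "i \<le> j" "j < length e" for i j
  proof (cases "i = j")
    case False
    have "e ! i < i" "i < j" "e ! (e ! i) = e ! i"
      using that False climb by auto
    then show ?thesis
      using assms(2) that(4) unfolding avoids_001 by blast
  qed simp
  have below: "e ! i < m" if "m \<le> i" "i < length e" for i
  proof -
    have "e ! m < m"
      using m bound[of m] that by auto
    then show ?thesis
      using repeated[of m i] that by simp
  qed
  have "0 < m"
    using m bound[of 0] assms(3) by (cases m) auto
  with le climb below repeated show ?thesis
    by (intro that) auto
qed

section \<open>The words left by the second pattern\<close>

definition climb_then :: "nat \<Rightarrow> nat \<times> nat \<Rightarrow> nat list" where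
  "climb_then n = (\<lambda>(m, a). map (\<lambda>i. if i < m then i else a) [0..<n])"

text \<open>The value \<open>c a\<close> after the plateau depends on the height \<open>a + 1\<close> of the plateau, so
  that \<open>c\<close> can be chosen as \<open>\<lambda>_. 0\<close> for the pattern 021 and as \<open>\<lambda>a. a\<close> for the pattern 120.\<close>

definition plateau_then :: "(nat \<Rightarrow> nat) \<Rightarrow> nat \<Rightarrow> nat \<times> nat \<Rightarrow> nat list" where
  "plateau_then c n = (\<lambda>(b, a). map (\<lambda>i. if i \<le> b then min i (Suc a) else c a) [0..<n])"

abbreviation pairs_below :: "nat \<Rightarrow> (nat \<times> nat) set" where
  "pairs_below n \<equiv> SIGMA b:{..<n}. {..<b}"

lemma length_climb_then [simp]: "length (climb_then n p) = n"
  by (simp add: climb_then_def split: prod.split)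

lemma nth_climb_then [simp]: "i < n \<Longrightarrow> climb_then n (m, a) ! i = (if i < m then i else a)"
  by (simp add: climb_then_def)

lemma length_plateau_then [simp]: "length (plateau_then c n p) = n"
  by (simp add: plateau_then_def split: prod.split)

lemma nth_plateau_then [simp]:
  "i < n \<Longrightarrow> plateau_then c n (b, a) ! i = (if i \<le> b then min i (Suc a) else c a)"
  by (simp add: plateau_then_def)

text \<open>The length of the climb is recovered as the first position whose entry differs from it.\<close>

lemma inj_on_climb_then: "inj_on (climb_then n) (pairs_below n)"
proof -
  have "m = m' \<and> a = a'"
    if "a < m" "m < n" "a' < m'" "m' < n" and eq: "climb_then n (m, a) = climb_then n (m', a')"
    for m a m' a'
  proof -
    have "climb_then n (m, a) ! m = climb_then n (m', a') ! m"
      "climb_then n (m, a) ! m' = climb_then n (m', a') ! m'"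
      using eq by simp_all
    then show ?thesis
      using that(1-4) by (auto split: if_splits)
  qed
  then show ?thesis
    by (auto simp: inj_on_def)
qed

lemma upt_notin_climb_then: "[0..<n] \<notin> climb_then n ` pairs_below n"
proof -
  have "[0..<n] \<noteq> climb_then n (m, a)" if "a < m" "m < n" for m a
  proof
    assume "[0..<n] = climb_then n (m, a)"
    then have "[0..<n] ! m = climb_then n (m, a) ! m" by simp
    with that show False by simp
  qed
  then show ?thesis by auto
qed

text \<open>The maximum \<open>Suc a\<close> is attained for the last time at position \<open>b\<close>.\<close>

lemma inj_on_plateau_then:
  assumes "\<And>a. c a \<le> a"
  shows "inj_on (plateau_then c n) (pairs_below n)"
proof -
  have "b = b' \<and> a = a'"
    if "a < b" "b < n" "a' < b'" "b' < n" and eq: "plateau_then c n (b, a) = plateau_then c n (b', a')"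
    for b a b' a'
  proof -
    have "plateau_then c n (b, a) ! b = plateau_then c n (b', a') ! b"
      "plateau_then c n (b, a) ! b' = plateau_then c n (b', a') ! b'"
      using eq by simp_all
    then show ?thesis
      using that(1-4) assms[of a] assms[of a'] by (auto simp: min_def split: if_splits)
  qed
  then show ?thesis
    by (auto simp: inj_on_def)
qed

lemma zeros_notin_plateau_then: "replicate n 0 \<notin> plateau_then c n ` pairs_below n"
proof -
  have "replicate n 0 \<noteq> plateau_then c n (b, a)" if "a < b" "b < n" for b a
  proof
    assume "replicate n 0 = plateau_then c n (b, a)"
    then have "replicate n 0 ! b = plateau_then c n (b, a) ! b" by simp
    with that show False by simp
  qed
  then show ?thesis by auto
qed

lemma card_insert_image_pairs_below:
  assumes "inj_on f (pairs_below n)" "z \<notin> f ` pairs_below n"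
  shows "card (insert z (f ` pairs_below n)) = (n choose 2) + 1"
proof -
  have "card (pairs_below n) = \<Sum>{..<n}"
    by simp
  also have "\<dots> = n choose 2"
    by (induction n) (simp_all add: numeral_2_eq_2)
  finally show ?thesis
    using assms by (simp add: card_image)
qed

text \<open>Once the tail takes only the values \<open>m - 1\<close> and \<open>c (m - 2)\<close>, its monotonicity puts all
  entries \<open>m - 1\<close> before all entries \<open>c (m - 2)\<close>. A climb of length 1 leaves only the zero word.\<close>

lemma climb_to_plateau_then:
  assumes "0 < m" "m \<le> length e"
    and climb: "\<And>i. i < m \<Longrightarrow> e ! i = i"
    and below: "\<And>i. m \<le> i \<Longrightarrow> i < length e \<Longrightarrow> e ! i < m"
    and decreasing: "\<And>i j. m \<le> i \<Longrightarrow> i \<le> j \<Longrightarrow> j < length e \<Longrightarrow> e ! j \<le> e ! i"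
    and two_values: "\<And>i. 2 \<le> m \<Longrightarrow> m \<le> i \<Longrightarrow> i < length e \<Longrightarrow> e ! i \<in> {c (m - 2), m - 1}"
  shows "e \<in> insert (replicate (length e) 0) (plateau_then c (length e) ` pairs_below (length e))"
proof (cases "m = 1")
  case True
  have "e ! i = 0" if "i < length e" for i
    using climb[of i] below[of i] that True by (cases "i < m") auto
  then have "e = replicate (length e) 0"
    by (auto intro: nth_equalityI)
  then show ?thesis by blast
next
  case False
  then have m: "2 \<le> m"
    using assms(1) by simp
  define b where "b = Max {i. i < length e \<and> e ! i = m - 1}"
  have top: "m - 1 \<in> {i. i < length e \<and> e ! i = m - 1}"
    using m assms(2) climb[of "m - 1"] by simp
  then have "b \<in> {i. i < length e \<and> e ! i = m - 1}"
    unfolding b_def by (intro Max_in) auto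
  moreover have "m - 1 \<le> b"
    unfolding b_def using top by (intro Max_ge) auto
  ultimately have b: "b < length e" "e ! b = m - 1" "m - 1 \<le> b"
    by simp_all
  have last: "i \<le> b" if "i < length e" "e ! i = m - 1" for i
    unfolding b_def using that by (auto intro: Max_ge)
  have "e = plateau_then c (length e) (b, m - 2)"
  proof (rule nth_equalityI)
    fix i assume i: "i < length e"
    consider "i < m" | "m \<le> i" "i \<le> b" | "m \<le> i" "b < i"
      by linarith
    then show "e ! i = plateau_then c (length e) (b, m - 2) ! i"
    proof cases
      case 1
      then show ?thesis using climb b m i by auto
    next
      case 2
      then have "e ! i = m - 1"
        using decreasing[of i b] below[of i] b i by simp
      then show ?thesis using 2 i m by simp
    next
      case 3
      then show ?thesis
        using two_values[of i] last[of i] m i by auto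
    qed
  qed simp
  moreover have "(b, m - 2) \<in> pairs_below (length e)"
    using b m by auto
  ultimately show ?thesis by blast
qed

section \<open>The three pattern pairs\<close>

lemma inversion_sequences_avoiding_001_110:
  assumes "n \<ge> 1"
  shows "inversion_sequences_avoiding n ([0, 0, 1], [1, 1, 0]) =
    insert [0..<n] (climb_then n ` pairs_below n)" (is "?L = ?R")
proof
  show "?L \<subseteq> ?R"
  proof
    fix e assume "e \<in> ?L"
    then have e: "length e = n" "inversion_sequence e" "avoids e [0, 0, 1]" "avoids e [1, 1, 0]"
      by (auto simp: inversion_sequences_avoiding_Pair)
    have "e \<noteq> []"
      using e(1) assms by auto
    from avoids_001_climb[OF e(2,3) this]
    obtain m where m: "m \<le> n" and climb: "\<And>i. i < m \<Longrightarrow> e ! i = i"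
      and below: "\<And>i. m \<le> i \<Longrightarrow> i < n \<Longrightarrow> e ! i < m"
      and decreasing: "\<And>i j. m \<le> i \<Longrightarrow> i \<le> j \<Longrightarrow> j < n \<Longrightarrow> e ! j \<le> e ! i"
      unfolding e(1) by metis
    show "e \<in> ?R"
    proof (cases "m = n")
      case True
      then have "e = [0..<n]"
        using climb e(1) by (auto intro: nth_equalityI)
      then show ?thesis by blast
    next
      case False
      then have "m < n" using m by simp
      have tail: "e ! i = e ! m" if "m < i" "i < n" for i
      proof (rule antisym)
        have "e ! m < m" "e ! (e ! m) = e ! m"
          using below[of m] climb \<open>m < n\<close> by auto
        then show "e ! m \<le> e ! i"
          using e(1,4) that unfolding avoids_110 by blast
        show "e ! i \<le> e ! m"
          using decreasing[of m i] that by simp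
      qed
      have "e = climb_then n (m, e ! m)"
      proof (rule nth_equalityI)
        fix i assume "i < length e"
        then show "e ! i = climb_then n (m, e ! m) ! i"
          using climb tail e(1) by (cases i m rule: linorder_cases) auto
      qed (simp add: e)
      moreover have "(m, e ! m) \<in> pairs_below n"
        using below[of m] \<open>m < n\<close> by simp
      ultimately show ?thesis by blast
    qed
  qed
  have "climb_then n (m, a) \<in> ?L" if "a < m" "m < n" for m a
    using that unfolding inversion_sequences_avoiding_Pair avoids_001 avoids_110 inversion_sequence_def
    by auto
  moreover have "[0..<n] \<in> ?L"
    unfolding inversion_sequences_avoiding_Pair avoids_001 avoids_110 inversion_sequence_def
    by auto
  ultimately show "?R \<subseteq> ?L" by auto
qed

lemma inversion_sequences_avoiding_001_021:
  assumes "n \<ge> 1"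
  shows "inversion_sequences_avoiding n ([0, 0, 1], [0, 2, 1]) =
    insert (replicate n 0) (plateau_then (\<lambda>_. 0) n ` pairs_below n)" (is "?L = ?R")
proof
  show "?L \<subseteq> ?R"
  proof
    fix e assume "e \<in> ?L"
    then have e: "length e = n" "inversion_sequence e" "avoids e [0, 0, 1]" "avoids e [0, 2, 1]"
      by (auto simp: inversion_sequences_avoiding_Pair)
    have "e \<noteq> []"
      using e(1) assms by auto
    with e(2,3) show "e \<in> ?R"
      unfolding e(1)[symmetric]
    proof (rule avoids_001_climb)
      fix m
      assume m: "0 < m" "m \<le> length e" and climb: "\<And>i. i < m \<Longrightarrow> e ! i = i"
        and below: "\<And>i. m \<le> i \<Longrightarrow> i < length e \<Longrightarrow> e ! i < m"
        and decreasing: "\<And>i j. m \<le> i \<Longrightarrow> i \<le> j \<Longrightarrow> j < length e \<Longrightarrow> e ! j \<le> e ! i"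
      have "e ! i \<in> {0, m - 1}" if "2 \<le> m" "m \<le> i" "i < length e" for i
      proof -
        have "0 < m - 1" "m - 1 < i" "e ! 0 = 0" "e ! (m - 1) = m - 1"
          using that climb by auto
        then have "e ! i = 0 \<or> m - 1 \<le> e ! i"
          using e(4) that(3) unfolding avoids_021 by (metis gr0I)
        then show ?thesis
          using below[of i] that by auto
      qed
      with m climb below decreasing
      show "e \<in> insert (replicate (length e) 0)
          (plateau_then (\<lambda>_. 0) (length e) ` pairs_below (length e))"
        by (rule climb_to_plateau_then)
    qed
  qed
  have "plateau_then (\<lambda>_. 0) n (b, a) \<in> ?L" if "a < b" "b < n" for b a
    using that unfolding inversion_sequences_avoiding_Pair avoids_001 avoids_021 inversion_sequence_def
    by auto
  moreover have "replicate n 0 \<in> ?L"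
    unfolding inversion_sequences_avoiding_Pair avoids_001 avoids_021 inversion_sequence_def
    by auto
  ultimately show "?R \<subseteq> ?L" by auto
qed

lemma inversion_sequences_avoiding_001_120:
  assumes "n \<ge> 1"
  shows "inversion_sequences_avoiding n ([0, 0, 1], [1, 2, 0]) =
    insert (replicate n 0) (plateau_then (\<lambda>a. a) n ` pairs_below n)" (is "?L = ?R")
proof
  show "?L \<subseteq> ?R"
  proof
    fix e assume "e \<in> ?L"
    then have e: "length e = n" "inversion_sequence e" "avoids e [0, 0, 1]" "avoids e [1, 2, 0]"
      by (auto simp: inversion_sequences_avoiding_Pair)
    have "e \<noteq> []"
      using e(1) assms by auto
    with e(2,3) show "e \<in> ?R"
      unfolding e(1)[symmetric]
    proof (rule avoids_001_climb)
      fix m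
      assume m: "0 < m" "m \<le> length e" and climb: "\<And>i. i < m \<Longrightarrow> e ! i = i"
        and below: "\<And>i. m \<le> i \<Longrightarrow> i < length e \<Longrightarrow> e ! i < m"
        and decreasing: "\<And>i j. m \<le> i \<Longrightarrow> i \<le> j \<Longrightarrow> j < length e \<Longrightarrow> e ! j \<le> e ! i"
      have "e ! i \<in> {m - 2, m - 1}" if "2 \<le> m" "m \<le> i" "i < length e" for i
      proof -
        have "m - 2 < m - 1" "m - 1 < i" "e ! (m - 2) = m - 2" "e ! (m - 1) = m - 1"
          using that climb by auto
        then have "m - 2 \<le> e ! i"
          using e(4) that(3) unfolding avoids_120 by metis
        then show ?thesis
          using below[of i] that by auto
      qed
      with m climb below decreasing
      show "e \<in> insert (replicate (length e) 0)
          (plateau_then (\<lambda>a. a) (length e) ` pairs_below (length e))"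
        by (rule climb_to_plateau_then)
    qed
  qed
  have "plateau_then (\<lambda>a. a) n (b, a) \<in> ?L" if "a < b" "b < n" for b a
    using that unfolding inversion_sequences_avoiding_Pair avoids_001 avoids_120 inversion_sequence_def
    by auto
  moreover have "replicate n 0 \<in> ?L"
    unfolding inversion_sequences_avoiding_Pair avoids_001 avoids_120 inversion_sequence_def
    by auto
  ultimately show "?R \<subseteq> ?L" by auto
qed

theorem theorem2p5:
  fixes n :: nat and p :: "nat list \<times> nat list"
  assumes "n \<ge> 1"
    and "p \<in> {([0,0,1], [1,1,0]), ([0,0,1], [0,2,1]), ([0,0,1], [1,2,0])}"
  shows "card (inversion_sequences_avoiding n p) = (n choose 2) + 1 \<and>
         (n choose 2) + 1 = central_polygonal n"
proof
  from assms(2) consider "p = ([0,0,1], [1,1,0])" | "p = ([0,0,1], [0,2,1])"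
    | "p = ([0,0,1], [1,2,0])"
    by blast
  then show "card (inversion_sequences_avoiding n p) = (n choose 2) + 1"
  proof cases
    case 1
    then show ?thesis
      using inversion_sequences_avoiding_001_110[OF assms(1)]
        card_insert_image_pairs_below[OF inj_on_climb_then upt_notin_climb_then] by simp
  next
    case 2
    then show ?thesis
      using inversion_sequences_avoiding_001_021[OF assms(1)]
        card_insert_image_pairs_below[OF inj_on_plateau_then zeros_notin_plateau_then,
          of "\<lambda>_. 0"] by simp
  next
    case 3
    then show ?thesis
      using inversion_sequences_avoiding_001_120[OF assms(1)]
        card_insert_image_pairs_below[OF inj_on_plateau_then zeros_notin_plateau_then,
          of "\<lambda>a. a"] by simp
  qed
  show "(n choose 2) + 1 = central_polygonal n"
    by (simp add: central_polygonal_def choose_two)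
qed

end
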